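(* For every algebraic number $\alpha\notin\mathbb{Z}_{\ge 0}$, the ring of integers $\mathcal{O}_{\mathbb{Q}(\alpha)}$ of the field $\mathbb{Q}(\alpha)$ satisfies $\mathcal{O}_{\mathbb{Q}(\alpha)}\subset R_+(\alpha)$.
   Context: For $\alpha\in\mathbb{C}$, $R_+(\alpha)$ denotes the set of all finite sums $\sum_{k\ge 0} a_k\binom{\alpha}{k}$ with $a_k\in\mathbb{Z}_{\ge 0}$, where $\binom{\alpha}{k}=\frac{\alpha(\alpha-1)\cdots(\alpha-k+1)}{k!}$. *)

theory Defs
  imports Complex_Main "HOL-Algebra.Algebraic_Closure_Type" "HOL-Algebra.Generated_Fields"
begin

text \<open>Finite sums are encoded by coefficient families \<open>a\<close> of finite support.\<close>

definition R_plus :: "complex \<Rightarrow> complex set" where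
  "R_plus \<alpha> = {\<Sum>k | a k \<noteq> 0. of_nat (a k) * (\<alpha> gchoose k) | a :: nat \<Rightarrow> nat. finite {k. a k \<noteq> 0}}"

text \<open>
  \<open>\<rat>(\<alpha>)\<close> is the subfield of the complex numbers generated by \<open>\<alpha>\<close>; the rationals
  need not be adjoined, since every subfield contains them.
\<close>

definition rat_adjoin :: "complex \<Rightarrow> complex set" where
  "rat_adjoin \<alpha> = generate_field ring_of_type_algebra {\<alpha>}"

definition integers_of :: "complex set \<Rightarrow> complex set" where
  "integers_of K = {x \<in> K. algebraic_int x}"

end

theory Submission
  imports Defs "HOL-Number_Theory.Residues"
begin

text \<open>
  Let \<open>R\<close> be the ring of values at \<open>\<alpha>\<close> of the polynomials that are integer-valued on \<open>\<nat>\<close>; by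
  Newton interpolation it is the group generated by the numbers \<open>\<alpha> gchoose k\<close>.

  Negatives are harmless: let \<open>f\<close> be an integer polynomial of minimal degree with root \<open>\<alpha>\<close>, so
  that \<open>f m \<noteq> 0\<close> for \<open>m \<in> \<nat>\<close>. Expanding \<open>f\<close> around \<open>m\<close> turns \<open>f \<alpha> * (\<alpha> gchoose m) = 0\<close> into
  \<open>f m * (\<alpha> gchoose m) + (combination of \<alpha> gchoose k with k > m) = 0\<close>, with nonnegative
  coefficients for large \<open>m\<close>. Downward induction on \<open>m\<close> yields \<open>- (\<alpha> gchoose m) \<in> R_plus \<alpha>\<close> for
  all \<open>m\<close>, hence \<open>R \<subseteq> R_plus \<alpha>\<close>.

  Moreover \<open>R\<close> is integrally closed in \<open>\<rat>(\<alpha>)\<close>: by Fermat's little theorem it is stable under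
  \<open>x \<mapsto> (x ^ p - x) / p\<close> for every prime \<open>p\<close>. If \<open>y\<close> is integral and has a multiple in \<open>R\<close>,
  then some \<open>L > 0\<close> satisfies \<open>L * y ^ i \<in> R\<close> for all \<open>i\<close>; applying this map to \<open>L * y ^ i\<close>, with
  \<open>p\<close> a prime factor of \<open>L\<close>, shows that \<open>L / p\<close> has the same property, so \<open>L\<close> descends to 1.
\<close>

section \<open>Integral closedness from Frobenius quotients\<close>

lemma integral_closure_if_Frobenius_quotients:
  fixes R :: "'a :: field_char_0 set"
  assumes one: "1 \<in> R"
    and add: "\<And>x y. x \<in> R \<Longrightarrow> y \<in> R \<Longrightarrow> x + y \<in> R"
    and minus: "\<And>x. x \<in> R \<Longrightarrow> - x \<in> R"
    and mult: "\<And>x y. x \<in> R \<Longrightarrow> y \<in> R \<Longrightarrow> x * y \<in> R"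
    and Frob: "\<And>x p. x \<in> R \<Longrightarrow> Factorial_Ring.prime p \<Longrightarrow> (x ^ p - x) / of_nat p \<in> R"
    and int: "algebraic_int y" and N: "N > 0" "of_nat N * y \<in> R"
  shows "y \<in> R"
proof -
  have diff: "x - z \<in> R" if "x \<in> R" "z \<in> R" for x z
    using add[OF that(1) minus[OF that(2)]] by simp
  have zero: "0 \<in> R"
    using diff[OF one one] by simp
  have of_nat: "of_nat n \<in> R" for n
    by (induction n) (auto intro: zero one add)
  have of_int: "of_int n \<in> R" for n
    by (cases n rule: int_cases2) (auto intro: of_nat minus)
  have power: "x ^ n \<in> R" if "x \<in> R" for x n
    by (induction n) (auto intro: one mult that)
  have sum: "(\<Sum>i\<in>A. g i) \<in> R" if "\<And>i. i \<in> A \<Longrightarrow> g i \<in> R" for A :: "nat set" and g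
    using that by (induction A rule: infinite_finite_induct) (auto intro: zero add)
  obtain f where f: "poly f y = 0" "Polynomial.lead_coeff f = 1" "\<forall>i. poly.coeff f i \<in> \<int>"
    using int by (auto elim: algebraic_int.cases)
  define n where "n = Polynomial.degree f"
  have rec: "y ^ (n + i) = - (\<Sum>j<n. poly.coeff f j * y ^ (j + i))" for i
  proof -
    have "0 = poly f y * y ^ i" using f by simp
    also have "\<dots> = (\<Sum>j\<le>n. poly.coeff f j * y ^ (j + i))"
      unfolding poly_altdef n_def sum_distrib_right by (simp add: power_add mult_ac)
    also have "\<dots> = y ^ (n + i) + (\<Sum>j<n. poly.coeff f j * y ^ (j + i))"
      using f(2) by (simp add: n_def lessThan_Suc_atMost[symmetric])
    finally show ?thesis by (simp add: eq_neg_iff_add_eq_0)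
  qed
  \<comment> \<open>One denominator serves all powers of \<open>y\<close>: below the degree
    \<open>n\<close>, the factor \<open>N ^ n\<close> absorbs the \<open>N ^ i\<close> needed by
    \<open>y ^ i\<close>, and from \<open>n\<close> on the monic relation reduces to smaller
    exponents.\<close>
  have bounded: "of_nat (N ^ n) * y ^ i \<in> R" for i
  proof (induction i rule: less_induct)
    case (less i)
    show ?case
    proof (cases "i < n")
      case True
      then have "of_nat (N ^ n) = (of_nat N ^ (n - i) * of_nat N ^ i :: 'a)"
        by (simp add: power_add[symmetric])
      then have "of_nat (N ^ n) * y ^ i = of_nat N ^ (n - i) * (of_nat N * y) ^ i"
        by (simp add: power_mult_distrib)
      then show ?thesis using N by (auto intro!: mult power of_nat)
    next
      case False
      then obtain k where i: "i = n + k" using le_iff_add not_less by metis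
      have eq: "of_nat (N ^ n) * y ^ i = - (\<Sum>j<n. poly.coeff f j * (of_nat (N ^ n) * y ^ (j + k)))"
        by (simp add: i rec sum_distrib_left mult_ac)
      have "poly.coeff f j * (of_nat (N ^ n) * y ^ (j + k)) \<in> R" if "j < n" for j
      proof (rule mult)
        show "poly.coeff f j \<in> R" using f(3) of_int by (metis Ints_cases)
        show "of_nat (N ^ n) * y ^ (j + k) \<in> R" using less that i by simp
      qed
      then show ?thesis unfolding eq by (auto intro!: minus sum)
    qed
  qed
  have cancel: "y ^ i \<in> R" if "L > 0" "\<And>i. of_nat L * y ^ i \<in> R" for L i
    using that
  proof (induction L arbitrary: i rule: less_induct)
    case (less L)
    show ?case
    proof (cases "L = 1")
      case True
      then show ?thesis using less.prems(2)[of i] by simp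
    next
      case False
      then obtain p where p: "Factorial_Ring.prime p" "p dvd L" using prime_factor_nat by blast
      then obtain M where M: "L = p * M" by (auto elim: dvdE)
      have M_less: "M < L" "M > 0" using M less.prems(1) prime_gt_1_nat[OF p(1)] by auto
      have p0: "of_nat p \<noteq> (0::'a)" and "p \<ge> 2"
        using prime_gt_0_nat[OF p(1)] prime_ge_2_nat[OF p(1)] by auto
      \<comment> \<open>The bound \<open>p \<ge> 2\<close> matters: of the \<open>p\<close> factors
        \<open>L\<close> in the power, one is spent to split off \<open>p\<close> and another must
        survive to bring the hypothesis to bear on \<open>L * y ^ (i * p)\<close>. That the exponent
        grows to \<open>i * p\<close> is why all powers of \<open>y\<close> are carried
        along.\<close>
      then obtain q where q: "p = Suc (Suc q)" by (metis add_2_eq_Suc le_Suc_ex)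
      have "of_nat M * y ^ i \<in> R" for i
      proof -
        define r where "r = ((of_nat L * y ^ i) ^ p - of_nat L * y ^ i) / of_nat p"
        have r: "r \<in> R" unfolding r_def by (rule Frob[OF less.prems(2) p(1)])
        have Ly: "of_nat L * y ^ i = of_nat p * (of_nat M * y ^ i)"
          by (simp add: M)
        have pow: "(of_nat L * y ^ i) ^ p = of_nat p * (of_nat (M * L ^ q) * (of_nat L * y ^ (i * p)))"
        proof -
          have "(of_nat L * y ^ i) ^ p = of_nat L ^ p * y ^ (i * p)"
            by (simp only: power_mult_distrib power_mult)
          also have "of_nat L ^ p = of_nat L * of_nat L ^ q * (of_nat L :: 'a)"
            by (simp add: q)
          also have "\<dots> = of_nat p * of_nat M * of_nat L ^ q * of_nat L"
            using arg_cong[OF M, of "of_nat :: nat \<Rightarrow> 'a"] by simp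
          finally show ?thesis by (simp only: of_nat_mult of_nat_power mult.assoc)
        qed
        have "r = of_nat (M * L ^ q) * (of_nat L * y ^ (i * p)) - of_nat M * y ^ i"
          unfolding r_def pow by (subst Ly) (simp add: p0 prime_gt_0_nat[OF p(1)] diff_divide_distrib)
        then have "of_nat M * y ^ i = of_nat (M * L ^ q) * (of_nat L * y ^ (i * p)) - r"
          by simp
        then show ?thesis
          by (simp only:) (intro diff mult[OF of_nat less.prems(2)] r)
      qed
      then show ?thesis using less.IH[OF M_less] by blast
    qed
  qed
  have "N ^ n > 0" using N(1) by simp
  from cancel[OF this bounded, of 1] show ?thesis by simp
qed

section \<open>The cone generated by the binomials\<close>

text \<open>Adding one generator at a time gives closure properties by plain induction, without
  handling finite supports. The lower index bound expresses that relations between the binomials are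
  triangular.\<close>

inductive_set binomial_cone :: "complex \<Rightarrow> nat \<Rightarrow> complex set" for \<alpha> :: complex and m :: nat where
  zero: "0 \<in> binomial_cone \<alpha> m"
| add_binomial: "\<lbrakk>x \<in> binomial_cone \<alpha> m; m \<le> k\<rbrakk> \<Longrightarrow> x + (\<alpha> gchoose k) \<in> binomial_cone \<alpha> m"

lemma binomial_cone_add:
  assumes "x \<in> binomial_cone \<alpha> m" "y \<in> binomial_cone \<alpha> m"
  shows "x + y \<in> binomial_cone \<alpha> m"
  using assms(2)
  by induction (auto simp: assms(1) add.assoc[symmetric] intro: binomial_cone.add_binomial)

lemma binomial_in_cone: "m \<le> k \<Longrightarrow> \<alpha> gchoose k \<in> binomial_cone \<alpha> m"
  using binomial_cone.add_binomial[OF binomial_cone.zero] by force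

lemma binomial_cone_of_nat_mult:
  "x \<in> binomial_cone \<alpha> m \<Longrightarrow> of_nat n * x \<in> binomial_cone \<alpha> m"
  by (induction n) (auto simp: distrib_right intro: binomial_cone.zero binomial_cone_add)

lemma binomial_cone_antimono:
  assumes "n \<le> m" shows "binomial_cone \<alpha> m \<subseteq> binomial_cone \<alpha> n"
proof
  fix x assume "x \<in> binomial_cone \<alpha> m"
  then show "x \<in> binomial_cone \<alpha> n"
    by induction (use assms in \<open>auto intro: binomial_cone.intros\<close>)
qed

text \<open>Passes from generators to the whole tail in the downward induction below, where only the
  binomials of large index are known to have their negatives in the full cone.\<close>

lemma minus_binomial_cone:
  assumes "\<And>k. m \<le> k \<Longrightarrow> - (\<alpha> gchoose k) \<in> binomial_cone \<alpha> 0"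
    and "x \<in> binomial_cone \<alpha> m"
  shows "- x \<in> binomial_cone \<alpha> 0"
  using assms(2)
proof induction
  case (add_binomial x k)
  show ?case
    using binomial_cone_add[OF add_binomial.IH assms(1)[OF add_binomial.hyps(2)]] by simp
qed (simp add: binomial_cone.zero)

lemma binomial_cone_subset_R_plus: "binomial_cone \<alpha> 0 \<subseteq> R_plus \<alpha>"
proof
  fix x assume "x \<in> binomial_cone \<alpha> 0"
  then show "x \<in> R_plus \<alpha>"
  proof induction
    case zero
    show ?case unfolding R_plus_def by (auto intro!: exI[of _ "\<lambda>_. 0"])
  next
    case (add_binomial x k)
    then obtain a where fin: "finite {j. a j \<noteq> 0}"
      and x: "x = (\<Sum>j | a j \<noteq> 0. of_nat (a j) * (\<alpha> gchoose j))"
      unfolding R_plus_def by blast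
    define b where "b = a(k := Suc (a k))"
    \<comment> \<open>Whether or not \<open>k\<close> already lies in the support of
      \<open>a\<close>, splitting it off lets both sums range over
      \<open>insert k A\<close>.\<close>
    define A where "A = {j. a j \<noteq> 0} - {k}"
    have A: "finite A" "k \<notin> A" using fin by (auto simp: A_def)
    have b: "{j. b j \<noteq> 0} = insert k A" by (auto simp: b_def A_def)
    have "x = (\<Sum>j\<in>insert k A. of_nat (a j) * (\<alpha> gchoose j))"
      unfolding x using fin by (intro sum.mono_neutral_left) (auto simp: A_def)
    also have "\<dots> = of_nat (a k) * (\<alpha> gchoose k) + (\<Sum>j\<in>A. of_nat (b j) * (\<alpha> gchoose j))"
      using A by (auto simp: b_def intro!: sum.cong)
    finally have "x + (\<alpha> gchoose k) = (\<Sum>j\<in>insert k A. of_nat (b j) * (\<alpha> gchoose j))"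
      using A by (simp add: b_def algebra_simps)
    then show ?case unfolding R_plus_def using A b by (auto intro!: exI[of _ b])
  qed
qed

section \<open>The action of polynomials in \<alpha> on the binomials\<close>

text \<open>Split \<open>\<alpha> - n\<close> as \<open>(\<alpha> - k) + (k - n)\<close>: the first
  summand raises the index, the second is a nonnegative integer because
  \<open>n \<le> k\<close>.\<close>

lemma gbinomial_mult_diff:
  fixes \<alpha> :: complex
  assumes "n \<le> k"
  shows "(\<alpha> - of_nat n) * (\<alpha> gchoose k) =
    of_nat (Suc k) * (\<alpha> gchoose Suc k) + of_nat (k - n) * (\<alpha> gchoose k)"
  using gbinomial_mult_1[of \<alpha> k] assms by (simp add: of_nat_diff algebra_simps)

lemma binomial_cone_mult_diff:
  assumes "n \<le> m" "x \<in> binomial_cone \<alpha> m"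
  shows "(\<alpha> - of_nat n) * x \<in> binomial_cone \<alpha> m"
  using assms(2)
proof induction
  case (add_binomial x k)
  have "(\<alpha> - of_nat n) * (\<alpha> gchoose k) \<in> binomial_cone \<alpha> m"
    unfolding gbinomial_mult_diff[OF order_trans[OF assms(1) add_binomial.hyps(2)]]
    by (intro binomial_cone_add binomial_cone_of_nat_mult binomial_in_cone)
       (use add_binomial.hyps in simp_all)
  then show ?case using add_binomial.IH by (auto simp: distrib_left intro: binomial_cone_add)
qed (simp add: binomial_cone.zero)

lemma binomial_cone_mult:
  assumes "n \<le> m" "x \<in> binomial_cone \<alpha> m"
  shows "\<alpha> * x \<in> binomial_cone \<alpha> m"
  using binomial_cone_mult_diff[of 0 m x \<alpha>] assms by simp

abbreviation ieval :: "int poly \<Rightarrow> complex \<Rightarrow> complex" where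
  "ieval f x \<equiv> poly (map_poly of_int f) x"

text \<open>Modulo binomials of higher index, \<alpha> acts on \<open>\<alpha> gchoose m\<close> as
  the scalar \<open>m\<close>, hence \<open>f\<close> acts as \<open>f m\<close>. The remainder may
  have coefficients of both signs, so it is kept as a difference of two cone elements; the induction
  follows Horner's scheme.\<close>

lemma poly_times_binomial:
  "\<exists>v\<in>binomial_cone \<alpha> (Suc m). \<exists>w\<in>binomial_cone \<alpha> (Suc m).
    ieval f \<alpha> * (\<alpha> gchoose m) = of_int (poly f (int m)) * (\<alpha> gchoose m) + v - w"
proof (induction f)
  case 0
  show ?case using binomial_cone.zero by (auto intro!: bexI[of _ 0])
next
  case (pCons a h)
  let ?B = "\<alpha> gchoose m" and ?C = "binomial_cone \<alpha> (Suc m)"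
  from pCons.IH obtain v w where vw: "v \<in> ?C" "w \<in> ?C"
    "ieval h \<alpha> * ?B = of_int (poly h (int m)) * ?B + v - w" by blast
  define b where "b = poly h (int m)"
  define u where "u = of_nat (Suc m) * (\<alpha> gchoose Suc m)"
  have u: "u \<in> ?C" unfolding u_def by (intro binomial_cone_of_nat_mult binomial_in_cone) simp
  have uB: "\<alpha> * ?B = u + of_nat m * ?B"
    using gbinomial_mult_diff[of m m \<alpha>] by (simp add: u_def algebra_simps)
  \<comment> \<open>The positive and negative parts of \<open>b\<close> send the new multiple of
    \<open>u\<close> to \<open>v\<close> or to \<open>w\<close> respectively.\<close>
  have b: "of_int b = of_nat (nat b) - (of_nat (nat (- b)) :: complex)"
    by (cases "b \<ge> 0") auto
  have "ieval (pCons a h) \<alpha> * ?B = of_int a * ?B + \<alpha> * (ieval h \<alpha> * ?B)"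
    by (simp add: map_poly_pCons algebra_simps)
  also have "\<dots> = of_int a * ?B + of_int b * (\<alpha> * ?B) + \<alpha> * v - \<alpha> * w"
    unfolding vw(3) b_def by (simp add: algebra_simps)
  also have "\<dots> = of_int (poly (pCons a h) (int m)) * ?B
      + (of_nat (nat b) * u + \<alpha> * v) - (of_nat (nat (- b)) * u + \<alpha> * w)"
    unfolding uB by (simp add: b_def[symmetric] b algebra_simps)
  finally show ?case
    using u vw by (blast intro: binomial_cone_add binomial_cone_of_nat_mult binomial_cone_mult)
qed

text \<open>In Horner's scheme each step adds \<open>h m\<close> times a binomial of index
  \<open>Suc m\<close> to the remainder. For a positive leading coefficient and large
  \<open>m\<close> the value \<open>h m\<close> is positive, so nothing has to be
  subtracted.\<close>

lemma poly_times_binomial_eventually: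
  assumes "Polynomial.lead_coeff f > 0"
  shows "\<exists>M. \<forall>m\<ge>M. poly f (int m) > 0 \<and> (\<exists>w\<in>binomial_cone \<alpha> (Suc m).
    ieval f \<alpha> * (\<alpha> gchoose m) = of_int (poly f (int m)) * (\<alpha> gchoose m) + w)"
  using assms
proof (induction f)
  case (pCons a h)
  show ?case
  proof (cases "h = 0")
    case True
    with pCons.prems show ?thesis
      using binomial_cone.zero by (auto simp: map_poly_pCons intro!: bexI[of _ 0])
  next
    case False
    with pCons obtain M where M: "\<And>m. m \<ge> M \<Longrightarrow> poly h (int m) > 0 \<and> (\<exists>w\<in>binomial_cone \<alpha> (Suc m).
      ieval h \<alpha> * (\<alpha> gchoose m) = of_int (poly h (int m)) * (\<alpha> gchoose m) + w)" by auto
    show ?thesis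
    proof (intro exI allI impI conjI)
      fix m assume m: "max M (nat (\<bar>a\<bar> + 1)) \<le> m"
      let ?B = "\<alpha> gchoose m" and ?C = "binomial_cone \<alpha> (Suc m)"
      from M[of m] m obtain w where w: "poly h (int m) > 0" "w \<in> ?C"
        "ieval h \<alpha> * ?B = of_int (poly h (int m)) * ?B + w" by auto
      \<comment> \<open>A positive integer is at least 1, so
        \<open>m * h m \<ge> m > \<bar>a\<bar>\<close>, which outweighs the constant term
        \<open>a\<close>.\<close>
      have "int m * 1 \<le> int m * poly h (int m)" using w(1) by (intro mult_left_mono) auto
      then show "poly (pCons a h) (int m) > 0" using m by auto
      define b where "b = nat (poly h (int m))"
      have b: "poly h (int m) = int b" using w(1) by (simp add: b_def)
      define u where "u = of_nat (Suc m) * (\<alpha> gchoose Suc m)"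
      have u: "u \<in> ?C" unfolding u_def by (intro binomial_cone_of_nat_mult binomial_in_cone) simp
      have uB: "\<alpha> * ?B = u + of_nat m * ?B"
        using gbinomial_mult_diff[of m m \<alpha>] by (simp add: u_def algebra_simps)
      have "ieval (pCons a h) \<alpha> * ?B = of_int a * ?B + \<alpha> * (ieval h \<alpha> * ?B)"
        by (simp add: map_poly_pCons algebra_simps)
      also have "\<dots> = of_int a * ?B + of_nat b * (\<alpha> * ?B) + \<alpha> * w"
        unfolding w(3) b by (simp add: algebra_simps)
      also have "\<dots> = of_int (poly (pCons a h) (int m)) * ?B + (of_nat b * u + \<alpha> * w)"
        unfolding uB by (simp add: b algebra_simps)
      finally show "\<exists>w\<in>?C. ieval (pCons a h) \<alpha> * ?B = of_int (poly (pCons a h) (int m)) * ?B + w"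
        using u w by (blast intro: binomial_cone_add binomial_cone_of_nat_mult binomial_cone_mult)
    qed
  qed
qed simp

text \<open>One version covers both the integer polynomials vanishing at \<alpha> and the rational
  polynomials describing the field generated by \<alpha>.\<close>

lemma
  fixes h :: "'a :: comm_ring_1 \<Rightarrow> 'b :: comm_ring_1"
  assumes "h 0 = 0" and add: "\<And>x y. h (x + y) = h x + h y" and mult: "\<And>x y. h (x * y) = h x * h y"
  shows poly_map_poly_add: "poly (map_poly h (p + q)) x = poly (map_poly h p) x + poly (map_poly h q) x"
    and poly_map_poly_mult: "poly (map_poly h (p * q)) x = poly (map_poly h p) x * poly (map_poly h q) x"
proof -
  have *: "poly (map_poly h (p + q)) x = poly (map_poly h p) x + poly (map_poly h q) x" for p q
  proof -
    have "map_poly h (p + q) = map_poly h p + map_poly h q"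
      by (rule poly_eqI) (simp add: coeff_map_poly assms)
    then show ?thesis by simp
  qed
  show "poly (map_poly h (p + q)) x = poly (map_poly h p) x + poly (map_poly h q) x" by (rule *)
  have smult: "poly (map_poly h (Polynomial.smult c q)) x = h c * poly (map_poly h q) x" for c
  proof -
    have "map_poly h (Polynomial.smult c q) = Polynomial.smult (h c) (map_poly h q)"
      by (rule poly_eqI) (simp add: coeff_map_poly assms)
    then show ?thesis by simp
  qed
  show "poly (map_poly h (p * q)) x = poly (map_poly h p) x * poly (map_poly h q) x"
    by (induction p) (simp_all add: * smult map_poly_pCons assms(1) algebra_simps)
qed

section \<open>Negatives of the binomials\<close>

lemma minus_binomial_in_cone:
  assumes "algebraic \<alpha>" "\<alpha> \<notin> \<nat>"
  shows "- (\<alpha> gchoose m) \<in> binomial_cone \<alpha> 0"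
proof -
  note hom_add = poly_map_poly_add[where h = "of_int :: int \<Rightarrow> complex",
      OF of_int_0 of_int_add of_int_mult]
  note hom_mult = poly_map_poly_mult[where h = "of_int :: int \<Rightarrow> complex",
      OF of_int_0 of_int_add of_int_mult]
  obtain f0 where "f0 \<noteq> 0 \<and> ieval f0 \<alpha> = 0"
    using assms(1) by (elim algebraicE') blast
  then obtain f where f: "f \<noteq> 0" "ieval f \<alpha> = 0"
    and least: "\<And>g. g \<noteq> 0 \<Longrightarrow> ieval g \<alpha> = 0 \<Longrightarrow> Polynomial.degree f \<le> Polynomial.degree g"
    using ex_has_least_nat[of "\<lambda>f. f \<noteq> 0 \<and> ieval f \<alpha> = 0" f0 Polynomial.degree] by blast
  \<comment> \<open>Here \<open>\<alpha> \<notin> \<nat>\<close> enters: a root \<open>m\<close> of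
    \<open>f\<close> could be divided out, and the quotient would still vanish at \<alpha>,
    contradicting minimality of the degree.\<close>
  have nz: "poly f (int m) \<noteq> 0" for m
  proof
    assume "poly f (int m) = 0"
    then obtain q where q: "f = [:- int m, 1:] * q" by (auto simp: poly_eq_0_iff_dvd elim: dvdE)
    have q0: "q \<noteq> 0" using f q by auto
    have "ieval f \<alpha> = ieval [:- int m, 1:] \<alpha> * ieval q \<alpha>" unfolding q by (rule hom_mult)
    also have "ieval [:- int m, 1:] \<alpha> = \<alpha> - of_nat m" by (simp add: map_poly_pCons)
    finally have "ieval q \<alpha> = 0" using f(2) assms(2) by auto
    moreover have "Polynomial.degree f = Suc (Polynomial.degree q)"
      unfolding q using q0 by (subst degree_mult_eq) auto
    ultimately show False using least[OF q0] by simp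
  qed
  define g where "g = (if Polynomial.lead_coeff f > 0 then f else - f)"
  have g: "Polynomial.lead_coeff g > 0" "ieval g \<alpha> = 0"
    using f hom_add[of f "- f" \<alpha>] by (auto simp: g_def not_less order.order_iff_strict)
  obtain M where M: "\<And>m. m \<ge> M \<Longrightarrow> poly g (int m) > 0 \<and> (\<exists>w\<in>binomial_cone \<alpha> (Suc m).
      ieval g \<alpha> * (\<alpha> gchoose m) = of_int (poly g (int m)) * (\<alpha> gchoose m) + w)"
    using poly_times_binomial_eventually[OF g(1)] by blast
  \<comment> \<open>It suffices to negate some positive multiple, since
    \<open>- B = (n - 1) * B + - (n * B)\<close>.\<close>
  have reduce: "- (\<alpha> gchoose k) \<in> binomial_cone \<alpha> 0"
    if "n > 0" "- (of_nat n * (\<alpha> gchoose k)) \<in> binomial_cone \<alpha> 0" for k n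
  proof -
    have "- (\<alpha> gchoose k) = of_nat (n - 1) * (\<alpha> gchoose k) + - (of_nat n * (\<alpha> gchoose k))"
      using that(1) by (simp add: of_nat_diff algebra_simps)
    also have "\<dots> \<in> binomial_cone \<alpha> 0"
      using that(2) by (intro binomial_cone_add binomial_cone_of_nat_mult binomial_in_cone) auto
    finally show ?thesis .
  qed
  \<comment> \<open>The relation has positive coefficients for \<open>k \<ge> M\<close>; for smaller \<open>k\<close> its tail is already
    invertible in the cone by downward induction, so the signs there do not matter.\<close>
  have large: "- (\<alpha> gchoose k) \<in> binomial_cone \<alpha> 0" if "k \<ge> M" for k
  proof -
    from M[OF that] g(2) obtain w where w: "poly g (int k) > 0" "w \<in> binomial_cone \<alpha> (Suc k)"
      "of_int (poly g (int k)) * (\<alpha> gchoose k) + w = 0" by auto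
    then have "- (of_nat (nat (poly g (int k))) * (\<alpha> gchoose k)) = w"
      by (simp add: add_eq_0_iff)
    with w show ?thesis
      using binomial_cone_antimono[of 0 "Suc k"] by (intro reduce[of "nat (poly g (int k))"]) auto
  qed
  have "\<forall>k\<ge>n. - (\<alpha> gchoose k) \<in> binomial_cone \<alpha> 0" if "n \<le> M" for n
    using that
  proof (induction rule: inc_induct)
    case base
    show ?case using large by blast
  next
    case (step n)
    obtain v w where vw: "v \<in> binomial_cone \<alpha> (Suc n)" "w \<in> binomial_cone \<alpha> (Suc n)"
      "of_int (poly f (int n)) * (\<alpha> gchoose n) + v - w = 0"
      using poly_times_binomial[of \<alpha> n f] f(2) by auto
    have both: "x \<in> binomial_cone \<alpha> 0" "- x \<in> binomial_cone \<alpha> 0" if "x \<in> binomial_cone \<alpha> (Suc n)" for x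
      using that binomial_cone_antimono[of 0 "Suc n"] minus_binomial_cone[of "Suc n"] step.IH by auto
    have "v + - w \<in> binomial_cone \<alpha> 0" "w + - v \<in> binomial_cone \<alpha> 0"
      using both vw(1,2) by (blast intro: binomial_cone_add)+
    moreover have "of_int (poly f (int n)) * (\<alpha> gchoose n) = w + - v"
      using vw(3) by (simp add: algebra_simps)
    then have "- (of_nat (nat \<bar>poly f (int n)\<bar>) * (\<alpha> gchoose n)) =
      (if poly f (int n) > 0 then v + - w else w + - v)"
      by (cases "poly f (int n) > 0") (auto simp: abs_if not_less)
    ultimately have "- (\<alpha> gchoose n) \<in> binomial_cone \<alpha> 0"
      using nz[of n] by (intro reduce[of "nat \<bar>poly f (int n)\<bar>"]) auto
    with step.IH show ?case by (metis Suc_leI order.order_iff_strict)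
  qed
  from this[of 0] show ?thesis by simp
qed

section \<open>Newton interpolation at the natural numbers\<close>

definition binomial_poly :: "nat \<Rightarrow> complex poly" where
  "binomial_poly k = Polynomial.smult (1 / fact k) (\<Prod>i<k. [:- of_nat i, 1:])"

lemma poly_binomial_poly: "poly (binomial_poly k) x = x gchoose k"
  by (simp add: binomial_poly_def gbinomial_prod_rev poly_prod atLeast0LessThan)

lemma degree_binomial_poly_le: "Polynomial.degree (binomial_poly k) \<le> k"
proof -
  have "Polynomial.degree (\<Prod>i<k. [:- of_nat i, 1 :: complex:]) \<le> (\<Sum>i<k. 1)"
    using degree_prod_sum_le[of "{..<k}" "\<lambda>i. [:- of_nat i, 1 :: complex:]"] by (simp add: o_def)
  then show ?thesis
    unfolding binomial_poly_def by (auto intro: order_trans[OF Polynomial.degree_smult_le])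
qed

text \<open>Newton's expansion in the form of a closure principle, so that no coefficients need to
  be named. The induction runs downward on the number \<open>k\<close> of prescribed zeros
  \<open>0, ..., k - 1\<close>: with \<open>Suc d\<close> zeros and degree at most \<open>d\<close>
  the polynomial vanishes.\<close>

lemma Newton_interpolation_closed:
  fixes f :: "complex poly"
  assumes zero: "0 \<in> S"
    and step: "\<And>x c k. x \<in> S \<Longrightarrow> x + of_int c * (\<alpha> gchoose k) \<in> S"
    and deg: "Polynomial.degree f \<le> d"
    and int: "\<And>n. poly f (of_nat n) \<in> \<int>"
  shows "poly f \<alpha> \<in> S"
proof -
  have "\<forall>f. Polynomial.degree f \<le> d \<longrightarrow> (\<forall>n. poly f (of_nat n) \<in> \<int>) \<longrightarrow>
    (\<forall>i<k. poly f (of_nat i) = 0) \<longrightarrow> poly f \<alpha> \<in> S" if "k \<le> Suc d" for k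
    using that
  proof (induction rule: inc_induct)
    case base
    have "f = 0" if "Polynomial.degree f \<le> d" "\<forall>i<Suc d. poly f (of_nat i) = 0" for f :: "complex poly"
    proof (rule poly_eqI_degree)
      show "poly f x = poly 0 x" if "x \<in> of_nat ` {..d}" for x
        using that \<open>\<forall>i<Suc d. poly f (of_nat i) = 0\<close> by auto
      show "card (of_nat ` {..d} :: complex set) > Polynomial.degree f"
        "card (of_nat ` {..d} :: complex set) > Polynomial.degree (0 :: complex poly)"
        using that by (auto simp: card_image inj_on_def)
    qed
    then have "poly f \<alpha> \<in> S"
      if "Polynomial.degree f \<le> d" "\<forall>i<Suc d. poly f (of_nat i) = 0" for f :: "complex poly"
      using that zero by (metis poly_0)
    then show ?case by blast
  next
    case (step k)
    show ?case
    proof (intro allI impI)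
      fix f :: "complex poly"
      assume f: "Polynomial.degree f \<le> d" "\<forall>n. poly f (of_nat n) \<in> \<int>"
        "\<forall>i<k. poly f (of_nat i) = 0"
      obtain c where c: "poly f (of_nat k) = of_int c" using f(2) by (meson Ints_cases)
      \<comment> \<open>The binomial of index \<open>k\<close> is 1 at \<open>k\<close>, 0 at
        smaller naturals and an integer at all naturals, so subtracting it \<open>c\<close> times
        creates a zero at \<open>k\<close> and preserves the rest.\<close>
      define g where "g = f - Polynomial.smult (of_int c) (binomial_poly k)"
      have g: "poly g x = poly f x - of_int c * (x gchoose k)" for x
        by (simp add: g_def poly_binomial_poly)
      have "Polynomial.degree g \<le> d"
        unfolding g_def using f(1) step.hyps degree_binomial_poly_le[of k]
        by (intro Polynomial.degree_diff_le order_trans[OF Polynomial.degree_smult_le]) auto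
      moreover have "poly g (of_nat n) \<in> \<int>" for n
        using f(2) by (auto simp: g binomial_gbinomial[symmetric])
      moreover have "poly g (of_nat i) = 0" if "i < Suc k" for i
        using that f(3) c by (cases "i = k") (auto simp: g binomial_gbinomial[symmetric])
      ultimately have "poly g \<alpha> \<in> S" using step.IH by blast
      from assms(2)[OF this, of c k] show "poly f \<alpha> \<in> S" by (simp add: g)
    qed
  qed
  from this[of 0] deg int show ?thesis by auto
qed

section \<open>The ring of values of integer-valued polynomials\<close>

text \<open>Describing the ring by values rather than as a span of binomials makes closure under
  products and Frobenius quotients a pointwise matter.\<close>

definition integer_valued_at :: "complex \<Rightarrow> complex set" where
  "integer_valued_at \<alpha> = {poly f \<alpha> | f. \<forall>n::nat. poly f (of_nat n) \<in> \<int>}"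

lemma integer_valued_atI:
  "\<lbrakk>\<And>n::nat. poly f (of_nat n) \<in> \<int>; x = poly f \<alpha>\<rbrakk> \<Longrightarrow> x \<in> integer_valued_at \<alpha>"
  by (auto simp: integer_valued_at_def)

lemma integer_valued_atE:
  assumes "x \<in> integer_valued_at \<alpha>"
  obtains f where "\<forall>n::nat. poly f (of_nat n) \<in> \<int>" "x = poly f \<alpha>"
  using assms by (auto simp: integer_valued_at_def)

lemma integer_valued_at_self: "\<alpha> \<in> integer_valued_at \<alpha>"
  by (rule integer_valued_atI[of "[:0, 1:]"]) auto

lemma integer_valued_at_of_int: "of_int c \<in> integer_valued_at \<alpha>"
  by (rule integer_valued_atI[of "[:of_int c:]"]) auto

lemma integer_valued_at_add:
  assumes "x \<in> integer_valued_at \<alpha>" "y \<in> integer_valued_at \<alpha>"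
  shows "x + y \<in> integer_valued_at \<alpha>"
  using assms by (elim integer_valued_atE) (rule integer_valued_atI[of "f + g" for f g], auto)

lemma integer_valued_at_mult:
  assumes "x \<in> integer_valued_at \<alpha>" "y \<in> integer_valued_at \<alpha>"
  shows "x * y \<in> integer_valued_at \<alpha>"
  using assms by (elim integer_valued_atE) (rule integer_valued_atI[of "f * g" for f g], auto)

lemma prime_dvd_power_minus_self:
  fixes z :: int
  assumes "Factorial_Ring.prime p"
  shows "int p dvd z ^ p - z"
proof -
  \<comment> \<open>\<open>fermat_theorem\<close> concerns naturals, so \<open>z\<close> is replaced
    by its nonnegative residue.\<close>
  define a where "a = nat (z mod int p)"
  have p: "p > 0" using assms by (rule prime_gt_0_nat)
  then have a: "[z = int a] (mod int p)" by (simp add: a_def cong_def)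
  have "[a ^ p = a] (mod p)"
  proof (cases "p dvd a")
    case True
    then show ?thesis
      using p by (simp add: cong_def mod_eq_0_iff_dvd dvd_power_le[of p a 1 p, simplified])
  next
    case False
    have "[a * a ^ (p - 1) = a * 1] (mod p)"
      by (rule cong_scalar_left[OF fermat_theorem[OF assms False]])
    then show ?thesis using p by (cases p) auto
  qed
  then have "[int a ^ p = int a] (mod int p)" using cong_int_iff by force
  then have "[z ^ p = z] (mod int p)" using a by (meson cong_pow cong_sym cong_trans)
  then show ?thesis by (simp add: cong_iff_dvd_diff)
qed

text \<open>Fermat's theorem applied to each integer \<open>f n\<close> shows that the polynomial
  \<open>(f ^ p - f) / p\<close> is again integer-valued.\<close>

lemma integer_valued_at_Frobenius:
  assumes "x \<in> integer_valued_at \<alpha>" "Factorial_Ring.prime p"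
  shows "(x ^ p - x) / of_nat p \<in> integer_valued_at \<alpha>"
proof -
  obtain f where f: "\<forall>n::nat. poly f (of_nat n) \<in> \<int>" "x = poly f \<alpha>"
    using assms(1) by (rule integer_valued_atE)
  show ?thesis
  proof (rule integer_valued_atI)
    fix n :: nat
    obtain z where z: "poly f (of_nat n) = of_int z" using f(1) by (meson Ints_cases)
    obtain w where w: "z ^ p - z = int p * w"
      using prime_dvd_power_minus_self[OF assms(2)] by (auto elim: dvdE)
    have "of_int z ^ p - of_int z = of_nat p * (of_int w :: complex)"
      using arg_cong[OF w, of of_int] by simp
    then show "poly (Polynomial.smult (1 / of_nat p) (f ^ p - f)) (of_nat n) \<in> \<int>"
      using prime_gt_0_nat[OF assms(2)] by (simp add: z)
  qed (simp add: f(2))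
qed

lemma integer_valued_at_integrally_closed:
  assumes "algebraic_int y" "N > 0" "of_nat N * y \<in> integer_valued_at \<alpha>"
  shows "y \<in> integer_valued_at \<alpha>"
proof (rule integral_closure_if_Frobenius_quotients[OF _ _ _ _ _ assms])
  show "1 \<in> integer_valued_at \<alpha>" using integer_valued_at_of_int[of 1] by simp
  show "- x \<in> integer_valued_at \<alpha>" if "x \<in> integer_valued_at \<alpha>" for x
    using integer_valued_at_mult[OF integer_valued_at_of_int[of "-1"] that] by simp
qed (auto intro: integer_valued_at_add integer_valued_at_mult integer_valued_at_Frobenius)

text \<open>Newton coefficients are integers of either sign; the negative ones are absorbed by
  \<open>minus_binomial_in_cone\<close>.\<close>

lemma integer_valued_at_subset_R_plus:
  assumes "algebraic \<alpha>" "\<alpha> \<notin> \<nat>"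
  shows "integer_valued_at \<alpha> \<subseteq> R_plus \<alpha>"
proof
  fix x assume "x \<in> integer_valued_at \<alpha>"
  then obtain f where f: "\<forall>n::nat. poly f (of_nat n) \<in> \<int>" "x = poly f \<alpha>"
    by (elim integer_valued_atE)
  have "poly f \<alpha> \<in> binomial_cone \<alpha> 0"
  proof (rule Newton_interpolation_closed[OF binomial_cone.zero _ order_refl f(1)[rule_format]])
    fix x c k assume x: "x \<in> binomial_cone \<alpha> 0"
    have "of_int c * (\<alpha> gchoose k) \<in> binomial_cone \<alpha> 0"
    proof (cases "c \<ge> 0")
      case True
      then show ?thesis
        using binomial_cone_of_nat_mult[OF binomial_in_cone[of 0 k], where n = "nat c"] by simp
    next
      case False
      then show ?thesis
        using binomial_cone_of_nat_mult[OF minus_binomial_in_cone[OF assms, of k], where n = "nat (- c)"] by simp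
    qed
    then show "x + of_int c * (\<alpha> gchoose k) \<in> binomial_cone \<alpha> 0"
      using x by (rule binomial_cone_add[rotated])
  qed
  then show "x \<in> R_plus \<alpha>" using binomial_cone_subset_R_plus f(2) by auto
qed

section \<open>The field generated by \<alpha> and its denominators\<close>

abbreviation reval :: "rat poly \<Rightarrow> complex \<Rightarrow> complex" where
  "reval f x \<equiv> poly (map_poly of_rat f) x"

lemmas reval_add = poly_map_poly_add[where h = "of_rat :: rat \<Rightarrow> complex",
  OF of_rat_0 of_rat_add of_rat_mult]
lemmas reval_mult = poly_map_poly_mult[where h = "of_rat :: rat \<Rightarrow> complex",
  OF of_rat_0 of_rat_add of_rat_mult]

text \<open>Take \<open>f\<close> of minimal degree vanishing at \<alpha> and let \<open>d\<close>
  be its gcd with \<open>q\<close>. Since \<open>d\<close> does not vanish at \<alpha>, the cofactor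
  of \<open>d\<close> in \<open>f\<close> does, so minimality makes \<open>d\<close> constant, and a
  Bezout identity evaluated at \<alpha> gives the inverse.\<close>

lemma inverse_reval:
  assumes "algebraic \<alpha>" and nz: "reval q \<alpha> \<noteq> 0"
  shows "\<exists>r. inverse (reval q \<alpha>) = reval r \<alpha>"
proof -
  obtain f0 where "f0 \<noteq> 0" "ieval f0 \<alpha> = 0"
    using assms(1) by (elim algebraicE')
  moreover have "map_poly of_rat (map_poly of_int f0 :: rat poly) = (map_poly of_int f0 :: complex poly)"
    by (rule poly_eqI) (simp add: coeff_map_poly)
  moreover have "map_poly of_int f0 \<noteq> (0 :: rat poly)"
    using \<open>f0 \<noteq> 0\<close> by (auto simp: poly_eq_iff coeff_map_poly)
  ultimately have "map_poly of_int f0 \<noteq> (0 :: rat poly) \<and> reval (map_poly of_int f0) \<alpha> = 0"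
    by simp
  then obtain f where f: "f \<noteq> 0" "reval f \<alpha> = 0"
    and least: "\<And>g. g \<noteq> 0 \<Longrightarrow> reval g \<alpha> = 0 \<Longrightarrow> Polynomial.degree f \<le> Polynomial.degree g"
    using ex_has_least_nat[of "\<lambda>f. f \<noteq> 0 \<and> reval f \<alpha> = 0" _ Polynomial.degree] by blast
  define d where "d = gcd q f"
  obtain e where e: "f = d * e" unfolding d_def using gcd_dvd2[of q f] by (blast elim: dvdE)
  obtain s where s: "q = d * s" unfolding d_def using gcd_dvd1[of q f] by (blast elim: dvdE)
  have "reval d \<alpha> \<noteq> 0" using nz s by (auto simp: reval_mult)
  then have "reval e \<alpha> = 0" using f(2) e by (auto simp: reval_mult)
  moreover have "e \<noteq> 0" "d \<noteq> 0" using e f by auto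
  ultimately have "Polynomial.degree d = 0"
    using least[of e] degree_mult_eq[of d e] by (simp add: e)
  then obtain c where c: "d = [:c:]" by (rule degree_eq_zeroE)
  have c0: "c \<noteq> 0" using c \<open>d \<noteq> 0\<close> by auto
  obtain a b where "a * q + b * f = d"
    unfolding d_def using bezout_coefficients_fst_snd by blast
  then have "reval (a * q + b * f) \<alpha> = of_rat c"
    by (simp add: c map_poly_pCons)
  then have "reval a \<alpha> * reval q \<alpha> = of_rat c"
    unfolding reval_add reval_mult f(2) by simp
  then have "reval ([:inverse c:] * a) \<alpha> * reval q \<alpha> = 1"
    using c0 by (subst reval_mult) (simp add: map_poly_pCons mult.assoc of_rat_mult[symmetric])
  then have "inverse (reval q \<alpha>) = reval ([:inverse c:] * a) \<alpha>"
    using nz by (simp add: field_simps)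
  then show ?thesis by blast
qed

text \<open>Values of rational polynomials at \<alpha> contain \<alpha> and are closed under all
  field operations, inverses being the only case that uses algebraicity.\<close>

lemma rat_adjoin_subset_reval:
  assumes "algebraic \<alpha>"
  shows "rat_adjoin \<alpha> \<subseteq> range (\<lambda>q. reval q \<alpha>)"
proof
  let ?K = "ring_of_type_algebra :: complex ring"
  interpret K: Ring.field ?K by (rule field_from_type_algebra)
  \<comment> \<open>Field generation is phrased with the operations of a ring record; these are
    identified with the usual ones on the complex numbers.\<close>
  have ops: "\<one>\<^bsub>?K\<^esub> = 1" "\<zero>\<^bsub>?K\<^esub> = 0" "x \<otimes>\<^bsub>?K\<^esub> y = x * y" "x \<oplus>\<^bsub>?K\<^esub> y = x + y" "carrier ?K = UNIV" for x y
    by (auto simp: ring_of_type_algebra_def)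
  have uminus: "\<ominus>\<^bsub>?K\<^esub> x = - x" for x
    by (rule K.minus_equality) (auto simp: ops)
  have inv: "inv\<^bsub>?K\<^esub> x = inverse x" if "x \<noteq> 0" for x
    by (rule K.comm_inv_char) (use that in \<open>auto simp: ops\<close>)
  fix x assume "x \<in> rat_adjoin \<alpha>"
  then show "x \<in> range (\<lambda>q. reval q \<alpha>)" unfolding rat_adjoin_def
  proof induction
    case one
    show ?case by (rule range_eqI[of _ _ 1]) (simp add: ops)
  next
    case (incl h)
    then show ?case by (intro range_eqI[of _ _ "[:0, 1:]"]) (simp add: map_poly_pCons)
  next
    case (a_inv h)
    then obtain q where q: "h = reval q \<alpha>" by blast
    show ?case
      by (rule range_eqI[of _ _ "[:-1:] * q"]) (subst reval_mult, simp add: q uminus map_poly_pCons)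
  next
    case (m_inv h)
    then show ?case using inverse_reval[OF assms] by (auto simp: ops inv)
  next
    case (eng_add h1 h2)
    then show ?case by (auto simp: ops reval_add[symmetric])
  next
    case (eng_mult h1 h2)
    then show ?case by (auto simp: ops reval_mult[symmetric])
  qed
qed

text \<open>Supplies the multiple \<open>N\<close> on which the integral closure argument starts;
  denominators are cleared one coefficient at a time.\<close>

lemma reval_times_nat_integer_valued:
  "\<exists>N>0. of_nat N * reval q \<alpha> \<in> integer_valued_at \<alpha>"
proof (induction q)
  case 0
  show ?case using integer_valued_at_of_int[of 0] by (intro exI[of _ 1]) simp
next
  case (pCons a q)
  then obtain N where N: "N > 0" "of_nat N * reval q \<alpha> \<in> integer_valued_at \<alpha>" by blast
  obtain u v where uv: "v > 0" "a = of_int u / of_int v" using quotient_of_denom_pos' quotient_of_div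
    by (metis prod.collapse)
  have va: "of_nat (nat v) * of_rat a = (of_int u :: complex)"
    using uv by (simp add: of_rat_divide)
  have "of_nat (nat v * N) * reval (pCons a q) \<alpha>
      = of_int (int N) * (of_nat (nat v) * of_rat a) + of_int (int (nat v)) * (\<alpha> * (of_nat N * reval q \<alpha>))"
    by (simp add: map_poly_pCons algebra_simps)
  also have "\<dots> \<in> integer_valued_at \<alpha>"
    unfolding va
    by (rule integer_valued_at_add[OF
          integer_valued_at_mult[OF integer_valued_at_of_int integer_valued_at_of_int]
          integer_valued_at_mult[OF integer_valued_at_of_int
            integer_valued_at_mult[OF integer_valued_at_self N(2)]]])
  finally show ?case using N(1) uv(1) by (intro exI[of _ "nat v * N"]) auto
qed

theorem proposition5p3:
  fixes \<alpha> :: complex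
  assumes "algebraic \<alpha>" and "\<alpha> \<notin> \<nat>"
  shows "integers_of (rat_adjoin \<alpha>) \<subseteq> R_plus \<alpha>"
proof
  fix x assume "x \<in> integers_of (rat_adjoin \<alpha>)"
  then have x: "x \<in> rat_adjoin \<alpha>" "algebraic_int x" by (auto simp: integers_of_def)
  from x(1) obtain q where "x = reval q \<alpha>" using rat_adjoin_subset_reval[OF assms(1)] by blast
  then obtain N where "N > 0" "of_nat N * x \<in> integer_valued_at \<alpha>"
    using reval_times_nat_integer_valued by blast
  then have "x \<in> integer_valued_at \<alpha>" by (rule integer_valued_at_integrally_closed[OF x(2)])
  then show "x \<in> R_plus \<alpha>" using integer_valued_at_subset_R_plus[OF assms] by blast
qed

end
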